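(* (Product of polynomials.) Let $F_b(z)=z^{-1}B_1+\cdots+z^{-n}B_n$ be a $p_b\times\rho$-valued polynomial and $F_c(z)=z^{-1}C_1+\cdots+z^{-l}C_l$ a $\rho\times m_c$-valued polynomial, and let $F_d$ be the $p_b\times m_c$-valued polynomial $$F_d(z):=F_b(z)F_c(z)=z^{-1}\left(z^{-1}D_1+\cdots+z^{-(n+l-1)}D_{n+l-1}\right).$$ Then the coefficients $D_1,\dots,D_{n+l-1}$ are given by $$\mathbf{D}=\mathbf{H}\,\mathbf{T}\,\mathbf{C},$$ where $\mathbf{D}$, $\mathbf{H}$, $\mathbf{T}$, $\mathbf{C}$ are the block matrices described in the context. Moreover, if $F_b\in\mathcal{U}$ and $F_c\in\mathcal{U}$, then $F_d\in\mathcal{U}$.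
   Context: All coefficients are constant complex matrices and $n,l$ are natural numbers. With $\mathbb{T}=\{z\in\mathbb{C}:|z|=1\}$, the class $\mathcal{U}$ consists of the $p\times m$-valued rational functions (for any dimensions $p,m$) with $F(z)^*F(z)=I_m$ for all $z\in\mathbb{T}$ if $p\ge m$ (isometry), and $F(z)F(z)^*=I_p$ for all $z\in\mathbb{T}$ if $m\ge p$ (co-isometry). The block matrices are as follows. $\mathbf{H}$ is the $(n+l)p_b\times(n+l)\rho$ block Hankel matrix whose first block row is $(0,\dots,0,B_1,\dots,B_n)$ with $l$ leading zero blocks, and whose $(r,s)$ block is $B_{r+s-1-l}$, where $B_i:=0_{p_b\times\rho}$ for $i\notin\{1,\dots,n\}$. $\mathbf{T}$ is the $(n+l)\rho\times(n+l)\rho$ block matrix with $I_\rho$ in each of the $n+l$ blocks of the block anti-diagonal and zeros elsewhere. $\mathbf{C}$ is the $(n+l)\rho\times m_c$ block column consisting of $0_{n\rho\times m_c}$ followed by $C_1,\dots,C_l$. $\mathbf{D}$ is the $(n+l)p_b\times m_c$ block column consisting of $0_{p_b\times m_c}$ followed by $D_1,\dots,D_{n+l-1}$.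
   Formalization: The last claim (F_d in U) is proved only when p_b ≥ ρ ≥ m_c or p_b ≤ ρ ≤ m_c; without this it is false: F_b = z^{-1}(1 0) and F_c = z^{-1}(0 1)^T are in U, but F_d = 0 is not. *)

theory Defs
  imports "Jordan_Normal_Form.Schur_Decomposition"
begin

(* Representatives are coprime, so F agrees with its reduced fraction at every point that is
   not a pole; values at poles are unconstrained. *)
definition rational_fun :: "(complex \<Rightarrow> complex) \<Rightarrow> bool" where
  "rational_fun f \<longleftrightarrow> (\<exists>P Q :: complex poly. Q \<noteq> 0 \<and> coprime P Q \<and>
     (\<forall>z. poly Q z \<noteq> 0 \<longrightarrow> f z = poly P z / poly Q z))"

definition rational_mat_fun :: "nat \<Rightarrow> nat \<Rightarrow> (complex \<Rightarrow> complex mat) \<Rightarrow> bool" where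
  "rational_mat_fun p m F \<longleftrightarrow> (\<forall>z. F z \<in> carrier_mat p m) \<and>
     (\<forall>i<p. \<forall>j<m. rational_fun (\<lambda>z. F z $$ (i, j)))"

(* Not closed under products: the 1 x 2 function (1/z, 0) and the 2 x 1 function (0, 1/z)^T
   belong to the class, their product is the 1 x 1 zero function (lemma class_U_not_closed
   below). Hence closure under products is only claimed for monotone dimensions
   p >= q >= m or p <= q <= m. *)
definition class_U :: "(complex \<Rightarrow> complex mat) set" where
  "class_U = {F. \<exists>p m. rational_mat_fun p m F \<and>
     (p \<ge> m \<longrightarrow> (\<forall>z. cmod z = 1 \<longrightarrow> mat_adjoint (F z) * F z = 1\<^sub>m m)) \<and>
     (m \<ge> p \<longrightarrow> (\<forall>z. cmod z = 1 \<longrightarrow> F z * mat_adjoint (F z) = 1\<^sub>m p))}"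

definition inv_poly_mat ::
  "nat \<Rightarrow> nat \<Rightarrow> nat \<Rightarrow> (nat \<Rightarrow> complex mat) \<Rightarrow> complex \<Rightarrow> complex mat" where
  "inv_poly_mat p m n A z = mat p m (\<lambda>(i, j). \<Sum>k = 1..n. inverse z ^ k * A k $$ (i, j))"

(* Blocks are numbered from 1, entries inside a matrix from 0. *)
definition block_mat ::
  "nat \<Rightarrow> nat \<Rightarrow> nat \<Rightarrow> nat \<Rightarrow> (nat \<Rightarrow> nat \<Rightarrow> complex mat) \<Rightarrow> complex mat" where
  "block_mat R S p m X = mat (R * p) (S * m)
     (\<lambda>(i, j). X (i div p + 1) (j div m + 1) $$ (i mod p, j mod m))"

definition coeff_ext ::
  "nat \<Rightarrow> nat \<Rightarrow> nat \<Rightarrow> (nat \<Rightarrow> complex mat) \<Rightarrow> int \<Rightarrow> complex mat" where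
  "coeff_ext p m n A k = (if 1 \<le> k \<and> k \<le> int n then A (nat k) else 0\<^sub>m p m)"

definition H_mat :: "nat \<Rightarrow> nat \<Rightarrow> nat \<Rightarrow> nat \<Rightarrow> (nat \<Rightarrow> complex mat) \<Rightarrow> complex mat" where
  "H_mat p \<rho> n l B = block_mat (n + l) (n + l) p \<rho>
     (\<lambda>r s. coeff_ext p \<rho> n B (int r + int s - 1 - int l))"

definition T_mat :: "nat \<Rightarrow> nat \<Rightarrow> nat \<Rightarrow> complex mat" where
  "T_mat \<rho> n l = block_mat (n + l) (n + l) \<rho> \<rho>
     (\<lambda>r s. if r + s = n + l + 1 then 1\<^sub>m \<rho> else 0\<^sub>m \<rho> \<rho>)"

definition C_mat :: "nat \<Rightarrow> nat \<Rightarrow> nat \<Rightarrow> nat \<Rightarrow> (nat \<Rightarrow> complex mat) \<Rightarrow> complex mat" where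
  "C_mat \<rho> m n l C = block_mat (n + l) 1 \<rho> m
     (\<lambda>r _. if r \<le> n then 0\<^sub>m \<rho> m else C (r - n))"

definition D_mat :: "nat \<Rightarrow> nat \<Rightarrow> nat \<Rightarrow> nat \<Rightarrow> (nat \<Rightarrow> complex mat) \<Rightarrow> complex mat" where
  "D_mat p m n l D = block_mat (n + l) 1 p m
     (\<lambda>r _. if r = 1 then 0\<^sub>m p m else D (r - 1))"

lemma rational_fun_c_over_z: "rational_fun (\<lambda>z. inverse z * c)"
proof (cases "c = 0")
  case True then show ?thesis unfolding rational_fun_def
    by (intro exI[of _ 0] exI[of _ 1]) auto
next
  case False
  have "is_unit [:c:]" using False by (simp add: is_unit_const_poly_iff)
  then have "coprime [:c:] [:0,1:]" by (rule is_unit_left_imp_coprime)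
  then show ?thesis unfolding rational_fun_def
    by (intro exI[of _ "[:c:]"] exI[of _ "[:0,1:]"]) (auto simp: field_simps)
qed

lemma class_U_not_closed:
  fixes B C :: "nat \<Rightarrow> complex mat"
  defines "B \<equiv> (\<lambda>_. mat 1 2 (\<lambda>(i, j). if j = 0 then 1 else 0))"
    and "C \<equiv> (\<lambda>_. mat 2 1 (\<lambda>(i, j). if i = 0 then 0 else 1))"
  shows "inv_poly_mat 1 2 1 B \<in> class_U" "inv_poly_mat 2 1 1 C \<in> class_U"
    "(\<lambda>z. inv_poly_mat 1 2 1 B z * inv_poly_mat 2 1 1 C z) \<notin> class_U"
proof -
  have u: "inverse z * cnj (inverse z) = 1" if "cmod z = 1" for z
    using that complex_norm_square[of "inverse z"] by (simp add: norm_inverse)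
  have r1: "rational_mat_fun 1 2 (inv_poly_mat 1 2 1 B)"
    unfolding rational_mat_fun_def inv_poly_mat_def
    by (auto simp: rational_fun_c_over_z)
  have r2: "rational_mat_fun 2 1 (inv_poly_mat 2 1 1 C)"
    unfolding rational_mat_fun_def inv_poly_mat_def
    by (auto simp: rational_fun_c_over_z)
  show "inv_poly_mat 1 2 1 B \<in> class_U"
    unfolding class_U_def mem_Collect_eq
  proof (rule exI[of _ 1], rule exI[of _ 2], intro conjI r1 impI allI)
    fix z :: complex assume "cmod z = 1"
    then show "inv_poly_mat 1 2 1 B z * mat_adjoint (inv_poly_mat 1 2 1 B z) = 1\<^sub>m 1"
      using u[of z] by (intro eq_matI)
        (auto simp: inv_poly_mat_def B_def mat_adjoint_def mat_of_rows_def scalar_prod_def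
          conjugate_vec_def numeral_2_eq_2)
  qed auto
  show "inv_poly_mat 2 1 1 C \<in> class_U"
    unfolding class_U_def mem_Collect_eq
  proof (rule exI[of _ 2], rule exI[of _ 1], intro conjI r2 impI allI)
    fix z :: complex assume "cmod z = 1"
    then show "mat_adjoint (inv_poly_mat 2 1 1 C z) * inv_poly_mat 2 1 1 C z = 1\<^sub>m 1"
      using u[of z] by (intro eq_matI)
        (auto simp: inv_poly_mat_def C_def mat_adjoint_def mat_of_rows_def scalar_prod_def
          conjugate_vec_def numeral_2_eq_2 mult.commute)
  qed auto
  have z: "inv_poly_mat 1 2 1 B z * inv_poly_mat 2 1 1 C z = 0\<^sub>m 1 1" for z
    by (intro eq_matI) (auto simp: inv_poly_mat_def B_def C_def scalar_prod_def numeral_2_eq_2)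
  show "(\<lambda>z. inv_poly_mat 1 2 1 B z * inv_poly_mat 2 1 1 C z) \<notin> class_U"
  proof
    assume "(\<lambda>z. inv_poly_mat 1 2 1 B z * inv_poly_mat 2 1 1 C z) \<in> class_U"
    then obtain p m where
      c: "0\<^sub>m 1 1 \<in> (carrier_mat p m :: complex mat set)" and
      i: "p \<ge> m \<longrightarrow> (\<forall>z. cmod z = 1 \<longrightarrow> mat_adjoint (0\<^sub>m 1 1) * 0\<^sub>m 1 1 = (1\<^sub>m m :: complex mat))"
      unfolding class_U_def rational_mat_fun_def z by blast
    from c have "p = 1" "m = 1" by auto
    with i have e: "mat_adjoint (0\<^sub>m 1 1) * 0\<^sub>m 1 1 = (1\<^sub>m 1 :: complex mat)"
      using norm_one[where 'a = complex] by blast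
    have "(mat_adjoint (0\<^sub>m 1 1) * 0\<^sub>m 1 1 :: complex mat) $$ (0,0) = 0"
      by (simp add: mat_adjoint_def mat_of_rows_def scalar_prod_def)
    with e show False by simp
  qed
qed

end

theory Submission
  imports Defs "HOL-Computational_Algebra.Field_as_Ring"
begin

text \<open>
  Put \<open>w = inverse z\<close>. Entrywise the factors are ordinary polynomials in \<open>w\<close> without constant term
  (\<open>entry_poly\<close>), so each entry of the product is a polynomial in \<open>w\<close> whose coefficient at \<open>w ^ t\<close> is
  the convolution \<open>\<Sum>k. B\<^bsub>t - k\<^esub> C\<^bsub>k\<^esub>\<close> (\<open>coeff_prod_entry_poly\<close>). It vanishes for \<open>t < 2\<close> and for
  \<open>t > n + l\<close>, which gives the existence of the coefficients \<open>D\<close>. A polynomial is determined by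
  its values at the infinitely many points \<open>w \<noteq> 0\<close>, so any admissible \<open>D\<close> has \<open>D\<^bsub>t - 1\<^esub>\<close> equal to
  that convolution.

  On the other side, the block anti-diagonal matrix reverses the order of the blocks of the column
  of the \<open>C\<close>'s (\<open>T_mat_mult_column\<close>), which turns the Hankel matrix into a Toeplitz one; block row \<open>t\<close>
  of the triple product is then the same convolution (\<open>index_H_T_C\<close>).

  For monotone dimensions the factors are both isometries or both co-isometries on the unit circle,
  and \<open>(F G)\<^sup>* = G\<^sup>* F\<^sup>*\<close> shows that the product is one too. The product is rational because
  \<open>P (inverse z)\<close> is the reflected polynomial of \<open>P\<close> divided by a power of \<open>z\<close>, and this
  fraction is reduced (\<open>rational_fun_poly_inverse\<close>).
\<close>

section \<open>Block matrices\<close>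

lemma index_block_mat:
  assumes "i < R * p" "j < S * m"
  shows "block_mat R S p m X $$ (i, j) = X (i div p + 1) (j div m + 1) $$ (i mod p, j mod m)"
  using assms by (simp add: block_mat_def)

lemma block_mat_carrier [simp]: "block_mat R S p m X \<in> carrier_mat (R * p) (S * m)"
  by (simp add: block_mat_def)

lemma sum_blocks:
  fixes f :: "nat \<Rightarrow> nat \<Rightarrow> complex"
  shows "(\<Sum>k<S * m. f (k div m + 1) (k mod m)) = (\<Sum>s = 1..S. \<Sum>q<m. f s q)"
proof -
  have "(\<Sum>k<S * m. f (k div m + 1) (k mod m))
      = (\<Sum>s<S. \<Sum>k = s * m..<s * m + m. f (k div m + 1) (k mod m))"
    by (rule sum.nat_group [symmetric])
  also have "\<dots> = (\<Sum>s<S. \<Sum>q<m. f (s + 1) q)"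
  proof (rule sum.cong [OF refl])
    fix s
    have shift: "(\<Sum>k = s * m..<s * m + m. g k) = (\<Sum>q<m. g (s * m + q))" for g :: "nat \<Rightarrow> complex"
      by (rule sum.reindex_bij_witness [of _ "\<lambda>q. s * m + q" "\<lambda>k. k - s * m"]) auto
    show "(\<Sum>k = s * m..<s * m + m. f (k div m + 1) (k mod m)) = (\<Sum>q<m. f (s + 1) q)"
      unfolding shift by (rule sum.cong [OF refl]) simp
  qed
  also have "\<dots> = (\<Sum>s = 1..S. \<Sum>q<m. f s q)"
    by (rule sum.reindex_bij_witness [of _ "\<lambda>s. s - 1" Suc]) auto
  finally show ?thesis .
qed

lemma index_block_mat_mult:
  assumes i: "i < R * p" and j: "j < T * q"
  shows "(block_mat R S p m X * block_mat S T m q Y) $$ (i, j) =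
    (\<Sum>s = 1..S. \<Sum>k<m. X (i div p + 1) s $$ (i mod p, k) * Y s (j div q + 1) $$ (k, j mod q))"
proof -
  have "(block_mat R S p m X * block_mat S T m q Y) $$ (i, j) =
      (\<Sum>k<S * m. X (i div p + 1) (k div m + 1) $$ (i mod p, k mod m) *
        Y (k div m + 1) (j div q + 1) $$ (k mod m, j mod q))"
    using i j by (simp add: block_mat_def scalar_prod_def lessThan_atLeast0)
  also have "\<dots> = (\<Sum>s = 1..S. \<Sum>k<m.
      X (i div p + 1) s $$ (i mod p, k) * Y s (j div q + 1) $$ (k, j mod q))"
    by (rule sum_blocks)
  finally show ?thesis .
qed

lemma T_mat_mult_column:
  "T_mat \<rho> n l * block_mat (n + l) 1 \<rho> m Y = block_mat (n + l) 1 \<rho> m (\<lambda>s. Y (n + l + 1 - s))"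
proof (rule eq_matI)
  fix i j
  assume "i < dim_row (block_mat (n + l) 1 \<rho> m (\<lambda>s. Y (n + l + 1 - s)))"
    and "j < dim_col (block_mat (n + l) 1 \<rho> m (\<lambda>s. Y (n + l + 1 - s)))"
  then have i: "i < (n + l) * \<rho>" and j: "j < 1 * m"
    by (simp_all add: block_mat_def)
  define r where "r = i div \<rho> + 1"
  from i have "\<rho> > 0" by (cases \<rho>) auto
  then have i': "i mod \<rho> < \<rho>" by simp
  have r: "1 \<le> r" "r \<le> n + l"
    using i by (auto simp: r_def less_mult_imp_div_less Suc_le_eq)
  have "(T_mat \<rho> n l * block_mat (n + l) 1 \<rho> m Y) $$ (i, j) =
      (\<Sum>s = 1..n + l. \<Sum>k<\<rho>. (if r + s = n + l + 1 then 1\<^sub>m \<rho> else 0\<^sub>m \<rho> \<rho>) $$ (i mod \<rho>, k) *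
        Y s (j div m + 1) $$ (k, j mod m))"
    unfolding T_mat_def index_block_mat_mult [OF i j] r_def ..
  also have "\<dots> = (\<Sum>s = 1..n + l. if s = n + l + 1 - r
      then Y s (j div m + 1) $$ (i mod \<rho>, j mod m) else 0)"
  proof (rule sum.cong [OF refl])
    fix s assume s: "s \<in> {1..n + l}"
    have eq: "r + s = n + l + 1 \<longleftrightarrow> s = n + l + 1 - r"
      using s r by auto
    have "(\<Sum>k<\<rho>. 1\<^sub>m \<rho> $$ (i mod \<rho>, k) * Y s (j div m + 1) $$ (k, j mod m)) =
        (\<Sum>k<\<rho>. if k = i mod \<rho> then Y s (j div m + 1) $$ (k, j mod m) else 0)"
      using i' by (intro sum.cong refl) auto
    also have "\<dots> = Y s (j div m + 1) $$ (i mod \<rho>, j mod m)"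
      using i' by simp
    finally have one: "(\<Sum>k<\<rho>. 1\<^sub>m \<rho> $$ (i mod \<rho>, k) * Y s (j div m + 1) $$ (k, j mod m)) =
      Y s (j div m + 1) $$ (i mod \<rho>, j mod m)" .
    have zero: "(\<Sum>k<\<rho>. 0\<^sub>m \<rho> \<rho> $$ (i mod \<rho>, k) * Y s (j div m + 1) $$ (k, j mod m)) = 0"
      using i' by simp
    show "(\<Sum>k<\<rho>. (if r + s = n + l + 1 then 1\<^sub>m \<rho> else 0\<^sub>m \<rho> \<rho>) $$ (i mod \<rho>, k) *
        Y s (j div m + 1) $$ (k, j mod m)) =
      (if s = n + l + 1 - r then Y s (j div m + 1) $$ (i mod \<rho>, j mod m) else 0)"
      unfolding eq
    proof (cases "s = n + l + 1 - r")
      case True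
      show "(\<Sum>k<\<rho>. (if s = n + l + 1 - r then 1\<^sub>m \<rho> else 0\<^sub>m \<rho> \<rho>) $$ (i mod \<rho>, k) *
          Y s (j div m + 1) $$ (k, j mod m)) =
        (if s = n + l + 1 - r then Y s (j div m + 1) $$ (i mod \<rho>, j mod m) else 0)"
        unfolding if_P [OF True] by (rule one)
    next
      case False
      show "(\<Sum>k<\<rho>. (if s = n + l + 1 - r then 1\<^sub>m \<rho> else 0\<^sub>m \<rho> \<rho>) $$ (i mod \<rho>, k) *
          Y s (j div m + 1) $$ (k, j mod m)) =
        (if s = n + l + 1 - r then Y s (j div m + 1) $$ (i mod \<rho>, j mod m) else 0)"
        unfolding if_not_P [OF False] by (rule zero)
    qed
  qed
  also have "\<dots> = Y (n + l + 1 - r) (j div m + 1) $$ (i mod \<rho>, j mod m)"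
    using r by (simp only: sum.delta finite_atLeastAtMost) auto
  also have "\<dots> = block_mat (n + l) 1 \<rho> m (\<lambda>s. Y (n + l + 1 - s)) $$ (i, j)"
    unfolding index_block_mat [OF i j] r_def ..
  finally show "(T_mat \<rho> n l * block_mat (n + l) 1 \<rho> m Y) $$ (i, j) =
    block_mat (n + l) 1 \<rho> m (\<lambda>s. Y (n + l + 1 - s)) $$ (i, j)" .
qed (simp_all add: T_mat_def block_mat_def)

section \<open>Entries as polynomials in the inverse variable\<close>

text \<open>The polynomial \<open>a 1 w + \<dots> + a n w ^ n\<close>, without constant term. An entry of an
  \<open>inv_poly_mat\<close> is the value of such a polynomial at \<open>w = inverse z\<close>.\<close>

definition entry_poly :: "nat \<Rightarrow> (nat \<Rightarrow> complex) \<Rightarrow> complex poly" where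
  "entry_poly n a = (\<Sum>k = 1..n. monom (a k) k)"

lemma coeff_entry_poly: "coeff (entry_poly n a) k = (if 1 \<le> k \<and> k \<le> n then a k else 0)"
  by (simp add: entry_poly_def coeff_sum)

lemma poly_entry_poly: "poly (entry_poly n a) w = (\<Sum>k = 1..n. w ^ k * a k)"
  by (simp add: entry_poly_def poly_sum poly_monom mult.commute)

lemma index_inv_poly_mat:
  assumes "i < p" "j < m"
  shows "inv_poly_mat p m n A z $$ (i, j) = poly (entry_poly n (\<lambda>k. A k $$ (i, j))) (inverse z)"
  using assms by (simp add: inv_poly_mat_def poly_entry_poly)

text \<open>The entry \<open>(i, j)\<close> of the product of two matrices of such polynomials, with inner
  dimension \<open>\<rho>\<close>.\<close>

definition prod_entry_poly ::
  "nat \<Rightarrow> nat \<Rightarrow> nat \<Rightarrow> (nat \<Rightarrow> complex mat) \<Rightarrow> (nat \<Rightarrow> complex mat) \<Rightarrow> nat \<Rightarrow> nat \<Rightarrow> complex poly"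
  where "prod_entry_poly \<rho> n l B C i j =
    (\<Sum>q<\<rho>. entry_poly n (\<lambda>k. B k $$ (i, q)) * entry_poly l (\<lambda>k. C k $$ (q, j)))"

lemma inv_poly_mat_carrier [simp]: "inv_poly_mat p m n A z \<in> carrier_mat p m"
  by (simp add: inv_poly_mat_def)

lemma dim_inv_poly_mat [simp]:
  "dim_row (inv_poly_mat p m n A z) = p" "dim_col (inv_poly_mat p m n A z) = m"
  by (simp_all add: inv_poly_mat_def)

lemma index_inv_poly_mat_mult:
  assumes i: "i < p" and j: "j < m"
  shows "(inv_poly_mat p \<rho> n B z * inv_poly_mat \<rho> m l C z) $$ (i, j) =
    poly (prod_entry_poly \<rho> n l B C i j) (inverse z)"
  using assms
  by (simp add: prod_entry_poly_def poly_sum scalar_prod_def lessThan_atLeast0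
      index_inv_poly_mat)

lemma coeff_prod_entry_poly:
  "coeff (prod_entry_poly \<rho> n l B C i j) t = (\<Sum>q<\<rho>. \<Sum>k = 1..l.
    (if k < t \<and> t \<le> n + k then B (t - k) $$ (i, q) else 0) * C k $$ (q, j))"
proof -
  have "coeff (entry_poly n b * entry_poly l c) t =
      (\<Sum>k = 1..l. (if k < t \<and> t \<le> n + k then b (t - k) else 0) * c k)" for b c
  proof -
    have "coeff (entry_poly n b * entry_poly l c) t = coeff (entry_poly l c * entry_poly n b) t"
      by (simp add: mult.commute)
    also have "\<dots> = (\<Sum>k\<le>t. coeff (entry_poly l c) k * coeff (entry_poly n b) (t - k))"
      by (rule coeff_mult)
    also have "\<dots> = (\<Sum>k\<in>{1..l} \<inter> {..t}. c k * coeff (entry_poly n b) (t - k))"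
      by (rule sum.mono_neutral_cong_right) (auto simp: coeff_entry_poly)
    also have "\<dots> = (\<Sum>k = 1..l. (if k < t \<and> t \<le> n + k then b (t - k) else 0) * c k)"
      by (rule sum.mono_neutral_cong_left) (auto simp: coeff_entry_poly)
    finally show ?thesis .
  qed
  then show ?thesis by (simp add: prod_entry_poly_def coeff_sum)
qed

lemma index_H_T_C:
  assumes i: "i < (n + l) * p" and j: "j < m"
  shows "(H_mat p \<rho> n l B * T_mat \<rho> n l * C_mat \<rho> m n l C) $$ (i, j) =
    coeff (prod_entry_poly \<rho> n l B C (i mod p) j) (i div p + 1)"
proof -
  define r where "r = i div p + 1"
  define h where "h s = coeff_ext p \<rho> n B (int r + int s - 1 - int l)" for s
  define Y :: "nat \<Rightarrow> complex mat" where "Y s = (if s \<le> n then 0\<^sub>m \<rho> m else C (s - n))" for s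
  from i have "p > 0" by (cases p) auto
  then have i': "i mod p < p" by simp
  have j': "j < 1 * m" using j by simp
  have "H_mat p \<rho> n l B * T_mat \<rho> n l * C_mat \<rho> m n l C =
      H_mat p \<rho> n l B * (T_mat \<rho> n l * C_mat \<rho> m n l C)"
    by (rule assoc_mult_mat) (auto simp: H_mat_def T_mat_def C_mat_def block_mat_def)
  also have "\<dots> = H_mat p \<rho> n l B * block_mat (n + l) 1 \<rho> m (\<lambda>s _. Y (n + l + 1 - s))"
    unfolding C_mat_def T_mat_mult_column Y_def ..
  finally have "(H_mat p \<rho> n l B * T_mat \<rho> n l * C_mat \<rho> m n l C) $$ (i, j) =
      (\<Sum>s = 1..n + l. \<Sum>q<\<rho>. h s $$ (i mod p, q) * Y (n + l + 1 - s) $$ (q, j mod m))"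
    unfolding H_mat_def by (simp only: index_block_mat_mult [OF i j'] h_def r_def)
  also have "\<dots> = (\<Sum>q<\<rho>. \<Sum>s = 1..n + l. h s $$ (i mod p, q) * Y (n + l + 1 - s) $$ (q, j))"
    using j by (subst sum.swap) simp
  also have "\<dots> = (\<Sum>q<\<rho>. \<Sum>k = 1..l.
      (if k < r \<and> r \<le> n + k then B (r - k) $$ (i mod p, q) else 0) * C k $$ (q, j))"
  proof (rule sum.cong [OF refl])
    fix q assume "q \<in> {..<\<rho>}"
    then have q: "q < \<rho>" by simp
    have "(\<Sum>s = 1..n + l. h s $$ (i mod p, q) * Y (n + l + 1 - s) $$ (q, j)) =
        (\<Sum>s = 1..l. h s $$ (i mod p, q) * C (l + 1 - s) $$ (q, j))"
      using q j by (intro sum.mono_neutral_cong_right) (auto simp: Y_def)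
    also have "\<dots> = (\<Sum>k = 1..l. h (l + 1 - k) $$ (i mod p, q) * C k $$ (q, j))"
      by (rule sum.reindex_bij_witness [of _ "\<lambda>k. l + 1 - k" "\<lambda>s. l + 1 - s"]) auto
    also have "\<dots> = (\<Sum>k = 1..l.
        (if k < r \<and> r \<le> n + k then B (r - k) $$ (i mod p, q) else 0) * C k $$ (q, j))"
    proof (rule sum.cong [OF refl])
      fix k assume k: "k \<in> {1..l}"
      then have e: "int r + int (l + 1 - k) - 1 - int l = int r - int k"
        by (simp add: of_nat_diff)
      have "h (l + 1 - k) $$ (i mod p, q) =
          (if k < r \<and> r \<le> n + k then B (r - k) $$ (i mod p, q) else 0)"
        unfolding h_def e coeff_ext_def using i' q by (auto simp: nat_diff_distrib)
      then show "h (l + 1 - k) $$ (i mod p, q) * C k $$ (q, j) =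
          (if k < r \<and> r \<le> n + k then B (r - k) $$ (i mod p, q) else 0) * C k $$ (q, j)"
        by simp
    qed
    finally show "(\<Sum>s = 1..n + l. h s $$ (i mod p, q) * Y (n + l + 1 - s) $$ (q, j)) =
      (\<Sum>k = 1..l. (if k < r \<and> r \<le> n + k then B (r - k) $$ (i mod p, q) else 0) * C k $$ (q, j))" .
  qed
  also have "\<dots> = coeff (prod_entry_poly \<rho> n l B C (i mod p) j) r"
    by (rule coeff_prod_entry_poly [symmetric])
  finally show ?thesis unfolding r_def .
qed

text \<open>Leaving out \<open>inverse z = 0\<close> still leaves infinitely many points.\<close>

lemma poly_eqI_inverse:
  fixes P Q :: "complex poly"
  assumes "\<And>z. z \<noteq> 0 \<Longrightarrow> poly P (inverse z) = poly Q (inverse z)"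
  shows "P = Q"
proof (rule ccontr)
  assume "P \<noteq> Q"
  then have "finite {w. poly (P - Q) w = 0}" by (intro poly_roots_finite) simp
  moreover have "- {0} \<subseteq> {w. poly (P - Q) w = 0}"
  proof
    fix w :: complex assume "w \<in> - {0}"
    then show "w \<in> {w. poly (P - Q) w = 0}"
      using assms [of "inverse w"] by simp
  qed
  ultimately have "finite (- {0 :: complex})" by (rule rev_finite_subset)
  then have "finite (UNIV :: complex set)" by simp
  then show False by (simp add: infinite_UNIV_char_0)
qed

text \<open>The factor \<open>monom 1 1\<close> accounts for the leading \<open>inverse z\<close>: the coefficient \<open>D k\<close> belongs
  to the power \<open>k + 1\<close> of \<open>inverse z\<close>.\<close>

lemma index_smult_inv_poly_mat:
  assumes "i < p" "j < m"
  shows "(inverse z \<cdot>\<^sub>m inv_poly_mat p m N D z) $$ (i, j) =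
    poly (monom 1 1 * entry_poly N (\<lambda>k. D k $$ (i, j))) (inverse z)"
  using assms by (simp add: index_inv_poly_mat poly_monom)

lemma coeff_shift_entry_poly:
  "coeff (monom 1 1 * entry_poly N a) t = (if 2 \<le> t \<and> t \<le> N + 1 then a (t - 1) else 0)"
  by (auto simp: coeff_monom_mult coeff_entry_poly)

lemma D_mat_eq_H_T_C:
  assumes eq: "\<And>z. z \<noteq> 0 \<Longrightarrow> inv_poly_mat p \<rho> n B z * inv_poly_mat \<rho> m l C z =
    inverse z \<cdot>\<^sub>m inv_poly_mat p m (n + l - 1) D z"
  shows "D_mat p m n l D = H_mat p \<rho> n l B * T_mat \<rho> n l * C_mat \<rho> m n l C"
proof (rule eq_matI)
  fix i j
  assume "i < dim_row (H_mat p \<rho> n l B * T_mat \<rho> n l * C_mat \<rho> m n l C)"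
    and "j < dim_col (H_mat p \<rho> n l B * T_mat \<rho> n l * C_mat \<rho> m n l C)"
  then have i: "i < (n + l) * p" and j: "j < m"
    by (simp_all add: H_mat_def C_mat_def block_mat_def)
  from i have "p > 0" by (cases p) auto
  then have i': "i mod p < p" by simp
  have r: "i div p < n + l" using i by (rule less_mult_imp_div_less)
  have "prod_entry_poly \<rho> n l B C (i mod p) j =
      monom 1 1 * entry_poly (n + l - 1) (\<lambda>k. D k $$ (i mod p, j))"
  proof (rule poly_eqI_inverse)
    fix z :: complex assume "z \<noteq> 0"
    from arg_cong [OF eq [OF this], of "\<lambda>M. M $$ (i mod p, j)"]
    show "poly (prod_entry_poly \<rho> n l B C (i mod p) j) (inverse z) =
        poly (monom 1 1 * entry_poly (n + l - 1) (\<lambda>k. D k $$ (i mod p, j))) (inverse z)"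
      by (simp only: index_inv_poly_mat_mult [OF i' j] index_smult_inv_poly_mat [OF i' j])
  qed
  then have "(H_mat p \<rho> n l B * T_mat \<rho> n l * C_mat \<rho> m n l C) $$ (i, j) =
      (if 1 \<le> i div p then D (i div p) $$ (i mod p, j) else 0)"
    using r by (simp only: index_H_T_C [OF i j] coeff_shift_entry_poly) auto
  also have "\<dots> = D_mat p m n l D $$ (i, j)"
    using i i' j by (auto simp: D_mat_def block_mat_def)
  finally show "D_mat p m n l D $$ (i, j) =
    (H_mat p \<rho> n l B * T_mat \<rho> n l * C_mat \<rho> m n l C) $$ (i, j)" by simp
qed (simp_all add: D_mat_def H_mat_def C_mat_def block_mat_def)

lemma ex_product_coefficients:
  "\<exists>D. (\<forall>k. D k \<in> carrier_mat p m) \<and>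
     (\<forall>z. inv_poly_mat p \<rho> n B z * inv_poly_mat \<rho> m l C z =
       inverse z \<cdot>\<^sub>m inv_poly_mat p m (n + l - 1) D z)"
proof -
  define D where "D k = mat p m (\<lambda>(i, j). coeff (prod_entry_poly \<rho> n l B C i j) (k + 1))" for k
  have "inv_poly_mat p \<rho> n B z * inv_poly_mat \<rho> m l C z =
      inverse z \<cdot>\<^sub>m inv_poly_mat p m (n + l - 1) D z" for z
  proof (rule eq_matI)
    fix i j
    assume "i < dim_row (inverse z \<cdot>\<^sub>m inv_poly_mat p m (n + l - 1) D z)"
      and "j < dim_col (inverse z \<cdot>\<^sub>m inv_poly_mat p m (n + l - 1) D z)"
    then have i: "i < p" and j: "j < m" by simp_all
    have "prod_entry_poly \<rho> n l B C i j =
        monom 1 1 * entry_poly (n + l - 1) (\<lambda>k. D k $$ (i, j))"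
    proof (rule poly_eqI)
      fix t
      have "coeff (prod_entry_poly \<rho> n l B C i j) t = 0" if "\<not> (2 \<le> t \<and> t \<le> n + l - 1 + 1)"
        unfolding coeff_prod_entry_poly using that by (intro sum.neutral ballI) auto
      then show "coeff (prod_entry_poly \<rho> n l B C i j) t =
          coeff (monom 1 1 * entry_poly (n + l - 1) (\<lambda>k. D k $$ (i, j))) t"
        using i j by (simp only: coeff_shift_entry_poly) (simp add: D_def)
    qed
    then show "(inv_poly_mat p \<rho> n B z * inv_poly_mat \<rho> m l C z) $$ (i, j) =
        (inverse z \<cdot>\<^sub>m inv_poly_mat p m (n + l - 1) D z) $$ (i, j)"
      by (simp only: index_inv_poly_mat_mult [OF i j] index_smult_inv_poly_mat [OF i j])
  qed simp_all
  moreover have "\<forall>k. D k \<in> carrier_mat p m" by (simp add: D_def)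
  ultimately show ?thesis by blast
qed

section \<open>Closure of the class under products\<close>

text \<open>The absence of a constant term matters only at \<open>z = 0\<close>: a nonconstant \<open>P\<close> has a pole there,
  where the value is unconstrained, and a constant one is zero.\<close>

lemma rational_fun_poly_inverse:
  assumes P0: "coeff P 0 = 0"
  shows "rational_fun (\<lambda>z. poly P (inverse z))"
proof -
  have "coprime (reflect_poly P) ([:0, 1:] ^ degree P)"
  proof (cases "P = 0")
    case True then show ?thesis by simp
  next
    case False
    then have "\<not> [:0, 1:] dvd reflect_poly P"
      using poly_eq_0_iff_dvd [of "reflect_poly P" 0] by simp
    then have "coprime [:0, 1:] (reflect_poly P)"
      by (intro prime_elem_imp_coprime prime_elem_linear_field_poly) simp_all
    then show ?thesis by (simp add: coprime_commute)
  qed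
  moreover have "poly P (inverse z) = poly (reflect_poly P) z / poly ([:0, 1:] ^ degree P) z"
    if "poly ([:0, 1:] ^ degree P) z \<noteq> 0" for z
  proof (cases "z = 0")
    case True
    with that have "degree P = 0" by (cases "degree P") simp_all
    with P0 have "P = 0" by (metis leading_coeff_0_iff)
    then show ?thesis by simp
  next
    case False
    then show ?thesis by (simp add: poly_reflect_poly_nz)
  qed
  ultimately show ?thesis unfolding rational_fun_def
    by (intro exI [of _ "reflect_poly P"] exI [of _ "[:0, 1:] ^ degree P"]) simp
qed

lemma rational_mat_fun_inv_poly_mat_mult:
  "rational_mat_fun p m (\<lambda>z. inv_poly_mat p \<rho> n B z * inv_poly_mat \<rho> m l C z)"
  unfolding rational_mat_fun_def
proof (intro conjI allI impI)
  fix z show "inv_poly_mat p \<rho> n B z * inv_poly_mat \<rho> m l C z \<in> carrier_mat p m"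
    by (rule mult_carrier_mat [OF inv_poly_mat_carrier inv_poly_mat_carrier])
next
  fix i j assume "i < p" "j < m"
  moreover have "coeff (prod_entry_poly \<rho> n l B C i j) 0 = 0"
    by (simp add: coeff_prod_entry_poly)
  ultimately show
    "rational_fun (\<lambda>z. (inv_poly_mat p \<rho> n B z * inv_poly_mat \<rho> m l C z) $$ (i, j))"
    by (simp only: index_inv_poly_mat_mult rational_fun_poly_inverse)
qed

lemma dim_mat_adjoint [simp]:
  "dim_row (mat_adjoint A) = dim_col A" "dim_col (mat_adjoint A) = dim_row A"
  by (simp_all add: mat_adjoint_def)

lemma index_mat_adjoint:
  "i < dim_col A \<Longrightarrow> j < dim_row A \<Longrightarrow> mat_adjoint A $$ (i, j) = conjugate (A $$ (j, i))"
  by (simp add: mat_adjoint_def mat_of_rows_def)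

lemma mat_adjoint_mult:
  fixes A B :: "complex mat"
  assumes "dim_col A = dim_row B"
  shows "mat_adjoint (A * B) = mat_adjoint B * mat_adjoint A"
  using assms
  by (intro eq_matI) (auto simp: index_mat_adjoint scalar_prod_def mult.commute)

lemma isometry_mult:
  fixes A B :: "complex mat"
  assumes A: "A \<in> carrier_mat p q" and B: "B \<in> carrier_mat q m"
    and iA: "mat_adjoint A * A = 1\<^sub>m q" and iB: "mat_adjoint B * B = 1\<^sub>m m"
  shows "mat_adjoint (A * B) * (A * B) = 1\<^sub>m m"
proof -
  have aA: "mat_adjoint A \<in> carrier_mat q p" and aB: "mat_adjoint B \<in> carrier_mat m q"
    using A B by auto
  have "mat_adjoint (A * B) * (A * B) = mat_adjoint B * mat_adjoint A * (A * B)"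
    using A B by (simp add: mat_adjoint_mult)
  also have "\<dots> = mat_adjoint B * (mat_adjoint A * (A * B))"
    by (rule assoc_mult_mat [OF aB aA mult_carrier_mat [OF A B]])
  also have "mat_adjoint A * (A * B) = mat_adjoint A * A * B"
    by (rule assoc_mult_mat [OF aA A B, symmetric])
  finally show ?thesis using iA iB B by simp
qed

lemma coisometry_mult:
  fixes A B :: "complex mat"
  assumes A: "A \<in> carrier_mat p q" and B: "B \<in> carrier_mat q m"
    and iA: "A * mat_adjoint A = 1\<^sub>m p" and iB: "B * mat_adjoint B = 1\<^sub>m q"
  shows "(A * B) * mat_adjoint (A * B) = 1\<^sub>m p"
proof -
  have aA: "mat_adjoint A \<in> carrier_mat q p" and aB: "mat_adjoint B \<in> carrier_mat m q"
    using A B by auto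
  have "(A * B) * mat_adjoint (A * B) = A * B * (mat_adjoint B * mat_adjoint A)"
    using A B by (simp add: mat_adjoint_mult)
  also have "\<dots> = A * (B * (mat_adjoint B * mat_adjoint A))"
    by (rule assoc_mult_mat [OF A B mult_carrier_mat [OF aB aA]])
  also have "B * (mat_adjoint B * mat_adjoint A) = B * mat_adjoint B * mat_adjoint A"
    by (rule assoc_mult_mat [OF B aB aA, symmetric])
  finally show ?thesis by (simp only: iA iB left_mult_one_mat [OF aA])
qed

text \<open>The dimensions in the definition of the class are existentially quantified; the carrier of the
  values fixes them.\<close>

lemma class_U_isometry:
  assumes F: "F \<in> class_U" and c: "\<And>z. F z \<in> carrier_mat p m"
  shows "m \<le> p \<Longrightarrow> cmod z = 1 \<Longrightarrow> mat_adjoint (F z) * F z = 1\<^sub>m m"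
    and "p \<le> m \<Longrightarrow> cmod z = 1 \<Longrightarrow> F z * mat_adjoint (F z) = 1\<^sub>m p"
proof -
  obtain p' m' where r: "rational_mat_fun p' m' F"
    and iso: "p' \<ge> m' \<longrightarrow> (\<forall>z. cmod z = 1 \<longrightarrow> mat_adjoint (F z) * F z = 1\<^sub>m m')"
    and coiso: "m' \<ge> p' \<longrightarrow> (\<forall>z. cmod z = 1 \<longrightarrow> F z * mat_adjoint (F z) = 1\<^sub>m p')"
    using F unfolding class_U_def by blast
  from r have "F 0 \<in> carrier_mat p' m'" by (simp add: rational_mat_fun_def)
  with c [of 0] have "p' = p" "m' = m" by auto
  with iso coiso show "m \<le> p \<Longrightarrow> cmod z = 1 \<Longrightarrow> mat_adjoint (F z) * F z = 1\<^sub>m m"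
    and "p \<le> m \<Longrightarrow> cmod z = 1 \<Longrightarrow> F z * mat_adjoint (F z) = 1\<^sub>m p"
    by auto
qed

lemma class_U_mult:
  assumes F: "F \<in> class_U" "\<And>z. F z \<in> carrier_mat p q"
    and G: "G \<in> class_U" "\<And>z. G z \<in> carrier_mat q m"
    and r: "rational_mat_fun p m (\<lambda>z. F z * G z)"
    and dims: "(p \<ge> q \<and> q \<ge> m) \<or> (p \<le> q \<and> q \<le> m)"
  shows "(\<lambda>z. F z * G z) \<in> class_U"
proof -
  have "mat_adjoint (F z * G z) * (F z * G z) = 1\<^sub>m m" if "m \<le> p" "cmod z = 1" for z
    \<comment> \<open>Where \<open>p \<le> q \<le> m\<close> as well, all three dimensions agree.\<close>
    using that dims
    by (intro isometry_mult [OF F(2) G(2)] class_U_isometry [OF F] class_U_isometry [OF G]) auto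
  moreover have "F z * G z * mat_adjoint (F z * G z) = 1\<^sub>m p" if "p \<le> m" "cmod z = 1" for z
    using that dims
    by (intro coisometry_mult [OF F(2) G(2)] class_U_isometry [OF F] class_U_isometry [OF G]) auto
  ultimately show ?thesis unfolding class_U_def using r by blast
qed

section \<open>The coefficients and the class of the product\<close>

theorem mainTheorem10:
  fixes p\<^sub>b \<rho> m\<^sub>c n l :: nat
    and B C :: "nat \<Rightarrow> complex mat"
    and F\<^sub>b F\<^sub>c F\<^sub>d :: "complex \<Rightarrow> complex mat"
  assumes B: "\<forall>k\<in>{1..n}. B k \<in> carrier_mat p\<^sub>b \<rho>"
    and C: "\<forall>k\<in>{1..l}. C k \<in> carrier_mat \<rho> m\<^sub>c"
    and F\<^sub>b: "F\<^sub>b = inv_poly_mat p\<^sub>b \<rho> n B"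
    and F\<^sub>c: "F\<^sub>c = inv_poly_mat \<rho> m\<^sub>c l C"
    and F\<^sub>d: "F\<^sub>d = (\<lambda>z. F\<^sub>b z * F\<^sub>c z)"
  shows "(\<exists>D. (\<forall>k\<in>{1..n+l-1}. D k \<in> carrier_mat p\<^sub>b m\<^sub>c) \<and>
            (\<forall>z. z \<noteq> 0 \<longrightarrow> F\<^sub>d z = inverse z \<cdot>\<^sub>m inv_poly_mat p\<^sub>b m\<^sub>c (n+l-1) D z)) \<and>
         (\<forall>D. (\<forall>k\<in>{1..n+l-1}. D k \<in> carrier_mat p\<^sub>b m\<^sub>c) \<and>
            (\<forall>z. z \<noteq> 0 \<longrightarrow> F\<^sub>d z = inverse z \<cdot>\<^sub>m inv_poly_mat p\<^sub>b m\<^sub>c (n+l-1) D z) \<longrightarrow>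
            D_mat p\<^sub>b m\<^sub>c n l D = H_mat p\<^sub>b \<rho> n l B * T_mat \<rho> n l * C_mat \<rho> m\<^sub>c n l C) \<and>
         ((p\<^sub>b \<ge> \<rho> \<and> \<rho> \<ge> m\<^sub>c) \<or> (p\<^sub>b \<le> \<rho> \<and> \<rho> \<le> m\<^sub>c) \<longrightarrow>
            F\<^sub>b \<in> class_U \<longrightarrow> F\<^sub>c \<in> class_U \<longrightarrow> F\<^sub>d \<in> class_U)"
proof (intro conjI impI allI)
  show "\<exists>D. (\<forall>k\<in>{1..n+l-1}. D k \<in> carrier_mat p\<^sub>b m\<^sub>c) \<and>
      (\<forall>z. z \<noteq> 0 \<longrightarrow> F\<^sub>d z = inverse z \<cdot>\<^sub>m inv_poly_mat p\<^sub>b m\<^sub>c (n+l-1) D z)"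
    using ex_product_coefficients [of p\<^sub>b m\<^sub>c \<rho> n B l C] unfolding F\<^sub>d F\<^sub>b F\<^sub>c by blast
next
  fix D
  assume "(\<forall>k\<in>{1..n+l-1}. D k \<in> carrier_mat p\<^sub>b m\<^sub>c) \<and>
    (\<forall>z. z \<noteq> 0 \<longrightarrow> F\<^sub>d z = inverse z \<cdot>\<^sub>m inv_poly_mat p\<^sub>b m\<^sub>c (n+l-1) D z)"
  then show "D_mat p\<^sub>b m\<^sub>c n l D = H_mat p\<^sub>b \<rho> n l B * T_mat \<rho> n l * C_mat \<rho> m\<^sub>c n l C"
    unfolding F\<^sub>d F\<^sub>b F\<^sub>c by (intro D_mat_eq_H_T_C) blast
next
  assume "(p\<^sub>b \<ge> \<rho> \<and> \<rho> \<ge> m\<^sub>c) \<or> (p\<^sub>b \<le> \<rho> \<and> \<rho> \<le> m\<^sub>c)"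
    and "F\<^sub>b \<in> class_U" and "F\<^sub>c \<in> class_U"
  then show "F\<^sub>d \<in> class_U"
    unfolding F\<^sub>d F\<^sub>b F\<^sub>c
    by (intro class_U_mult [where p = p\<^sub>b and q = \<rho> and m = m\<^sub>c]
        rational_mat_fun_inv_poly_mat_mult inv_poly_mat_carrier)
qed

end
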